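(* Let $(\mathcal{X},d)$ be a metric space, let $f,g:\mathcal{X}\to\mathcal{X}$ be maps and $F,G:\mathcal{X}\to\mathcal{P}_{fb}(\mathcal{X})$ be set-valued maps such that the pairs $\{f,F\}$ and $\{g,G\}$ are occasionally weakly compatible. Let $\varphi:(\mathbb{R}^+)^6\to\mathbb{R}$ be a function, written $\varphi(t_1,\dots,t_6)$, such that: (i) $\varphi$ is nondecreasing in the variable $t_1$ and nonincreasing in the variables $t_5$ and $t_6$; (ii) $\varphi(t,t,0,0,t,t)\ge 0$ for all $t>0$. Suppose that for all $x,y\in\mathcal{X}$ for which $\max\{d(fx,gy),d(fx,Fx),d(gy,Gy)\}>0$, $$\varphi\big(\delta(Fx,Gy),\,d(fx,gy),\,d(fx,Fx),\,d(gy,Gy),\,d(fx,Gy),\,d(gy,Fx)\big)<0 .$$ Then $f$, $g$, $F$ and $G$ have a unique common fixed point.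
   Context: $\mathcal{P}_{fb}(\mathcal{X})$ is the class of all nonempty bounded closed subsets of $\mathcal{X}$. $\mathbb{R}^+=[0,\infty)$. We write $fx=f(x)$, $Fx=F(x)$, and for $x\in\mathcal{X}$, $A,B\subseteq\mathcal{X}$, $d(x,A)=\inf\{d(x,y):y\in A\}$ and $\delta(A,B)=\sup\{d(a,b):a\in A,\,b\in B\}$. A pair $\{f,F\}$ with $f:\mathcal{X}\to\mathcal{X}$ and $F:\mathcal{X}\to\mathcal{P}_{fb}(\mathcal{X})$ is occasionally weakly compatible (owc) if there exists $x\in\mathcal{X}$ such that $fx\in Fx$ and $fFx\subseteq Ffx$, where $fFx=\{f(y):y\in F(x)\}$ and $Ffx=F(f(x))$. A common fixed point of $f,g,F,G$ is a point $w\in\mathcal{X}$ with $w=fw=gw$, $w\in Fw$ and $w\in Gw$. *)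

theory Defs
  imports "HOL-Analysis.Analysis"
begin

definition Pfb :: "'a::metric_space set set" where
  "Pfb = {A. A \<noteq> {} \<and> bounded A \<and> closed A}"

text \<open>
  The distance \<open>d(x,A)\<close> of a point to a set is \<^const>\<open>infdist\<close>, which is the infimum
  of the distances whenever \<open>A\<close> is nonempty. The function \<open>set_delta\<close> is meaningful for
  nonempty bounded arguments only, since \<^const>\<open>Sup\<close> on the reals is unspecified otherwise.
\<close>

definition set_delta :: "'a::metric_space set \<Rightarrow> 'a set \<Rightarrow> real" where
  "set_delta A B = Sup {dist a b | a b. a \<in> A \<and> b \<in> B}"

definition owc :: "('a \<Rightarrow> 'a) \<Rightarrow> ('a \<Rightarrow> 'a set) \<Rightarrow> bool" where
  "owc f F \<longleftrightarrow> (\<exists>x. f x \<in> F x \<and> f ` F x \<subseteq> F (f x))"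

definition common_fixed_point ::
  "('a \<Rightarrow> 'a) \<Rightarrow> ('a \<Rightarrow> 'a) \<Rightarrow> ('a \<Rightarrow> 'a set) \<Rightarrow> ('a \<Rightarrow> 'a set) \<Rightarrow> 'a \<Rightarrow> bool" where
  "common_fixed_point f g F G w \<longleftrightarrow> w = f w \<and> w = g w \<and> w \<in> F w \<and> w \<in> G w"

end

theory Submission
  imports Defs
begin

text \<open>Boundedness of both sets makes the set of distances bounded above, so the
  \<open>Sup\<close> in \<open>set_delta\<close> is a genuine upper bound.\<close>

lemma dist_le_set_delta:
  assumes "bounded A" "bounded B" "a \<in> A" "b \<in> B"
  shows "dist a b \<le> set_delta A B"
proof -
  have "{dist a b | a b. a \<in> A \<and> b \<in> B} = (\<lambda>(a, b). dist a b) ` (A \<times> B)"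
    by auto
  then have "bdd_above {dist a b | a b. a \<in> A \<and> b \<in> B}"
    using bounded_Times[OF assms(1,2)]
    by (auto simp: case_prod_unfold
        intro!: bounded_imp_bdd_above bounded_dist_comp bounded_fst bounded_snd)
  then show ?thesis
    unfolding set_delta_def by (rule cSup_upper[rotated]) (use assms in auto)
qed

text \<open>
  Any \<^term>\<open>x\<close> with \<^prop>\<open>f x \<in> F x\<close> and any \<^term>\<open>y\<close> with \<^prop>\<open>g y \<in> G y\<close> satisfy
  \<^prop>\<open>f x = g y\<close>: if \<open>t = d(fx,gy)\<close> were positive, monotonicity would turn the contractive
  inequality into \<open>\<phi>(t,t,0,0,t,t) < 0\<close>. Weak compatibility makes \<^term>\<open>f x\<close> another such point
  for the pair \<open>{f,F}\<close>, and likewise for \<open>{g,G}\<close>, so the common value is fixed by both maps.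
\<close>

theorem theorem2p4:
  fixes f g :: "'a::metric_space \<Rightarrow> 'a"
    and F G :: "'a \<Rightarrow> 'a set"
    and \<phi> :: "real \<Rightarrow> real \<Rightarrow> real \<Rightarrow> real \<Rightarrow> real \<Rightarrow> real \<Rightarrow> real"
  assumes "\<And>x. F x \<in> Pfb"
    and "\<And>x. G x \<in> Pfb"
    and "owc f F"
    and "owc g G"
    and "\<And>t2 t3 t4 t5 t6. \<lbrakk>t2 \<ge> 0; t3 \<ge> 0; t4 \<ge> 0; t5 \<ge> 0; t6 \<ge> 0\<rbrakk>
          \<Longrightarrow> mono_on {0..} (\<lambda>t1. \<phi> t1 t2 t3 t4 t5 t6)"
    and "\<And>t1 t2 t3 t4 t6. \<lbrakk>t1 \<ge> 0; t2 \<ge> 0; t3 \<ge> 0; t4 \<ge> 0; t6 \<ge> 0\<rbrakk>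
          \<Longrightarrow> antimono_on {0..} (\<lambda>t5. \<phi> t1 t2 t3 t4 t5 t6)"
    and "\<And>t1 t2 t3 t4 t5. \<lbrakk>t1 \<ge> 0; t2 \<ge> 0; t3 \<ge> 0; t4 \<ge> 0; t5 \<ge> 0\<rbrakk>
          \<Longrightarrow> antimono_on {0..} (\<lambda>t6. \<phi> t1 t2 t3 t4 t5 t6)"
    and "\<And>t. t > 0 \<Longrightarrow> \<phi> t t 0 0 t t \<ge> 0"
    and "\<And>x y. Max {dist (f x) (g y), infdist (f x) (F x), infdist (g y) (G y)} > 0
          \<Longrightarrow> \<phi> (set_delta (F x) (G y)) (dist (f x) (g y)) (infdist (f x) (F x))
                (infdist (g y) (G y)) (infdist (f x) (G y)) (infdist (g y) (F x)) < 0"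
  shows "\<exists>!w. common_fixed_point f g F G w"
proof -
  have coincide: "f x = g y" if x: "f x \<in> F x" and y: "g y \<in> G y" for x y
  proof (rule ccontr)
    assume "f x \<noteq> g y"
    define t where "t = dist (f x) (g y)"
    define s where "s = set_delta (F x) (G y)"
    define p where "p = infdist (f x) (G y)"
    define q where "q = infdist (g y) (F x)"
    have t: "t > 0"
      using \<open>f x \<noteq> g y\<close> by (simp add: t_def)
    have s: "t \<le> s"
      unfolding t_def s_def using assms(1)[of x] assms(2)[of y] x y
      by (intro dist_le_set_delta) (auto simp: Pfb_def)
    \<comment> \<open>The point \<open>g y\<close> of \<open>G y\<close> witnesses the bound on
      \<open>p\<close>; symmetrically \<open>f x\<close> in \<open>F x\<close> bounds
      \<open>q\<close>.\<close>
    have p: "0 \<le> p" "p \<le> t"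
      using infdist_le[OF y, of "f x"] by (simp_all add: p_def t_def infdist_nonneg)
    have q: "0 \<le> q" "q \<le> t"
      using infdist_le[OF x, of "g y"]
      by (simp_all add: q_def t_def infdist_nonneg dist_commute)
    have "0 \<le> \<phi> t t 0 0 t t"
      using assms(8) t .
    also have "\<dots> \<le> \<phi> s t 0 0 t t"
      using monotone_onD[OF assms(5), of t 0 0 t t t s] s t by simp
    also have "\<dots> \<le> \<phi> s t 0 0 p t"
      using monotone_onD[OF assms(6), of s t 0 0 t p t] s t p by simp
    also have "\<dots> \<le> \<phi> s t 0 0 p q"
      using monotone_onD[OF assms(7), of s t 0 0 p q t] s t p q by simp
    \<comment> \<open>The two zeros are \<open>infdist (f x) (F x)\<close> and
      \<open>infdist (g y) (G y)\<close>, which vanish by membership; the maximum is positive since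
      \<open>t > 0\<close>.\<close>
    also have "\<dots> < 0"
      using assms(9)[of x y] t x y by (simp add: t_def s_def p_def q_def)
    finally show False
      by simp
  qed
  from assms(3) obtain x where x: "f x \<in> F x" "f (f x) \<in> F (f x)"
    unfolding owc_def by blast
  from assms(4) obtain y where y: "g y \<in> G y" "g (g y) \<in> G (g y)"
    unfolding owc_def by blast
  \<comment> \<open>With \<open>w = f x = g y\<close>, the other two coincidences read
    \<open>f w = w\<close> and \<open>w = g w\<close>.\<close>
  have "common_fixed_point f g F G (f x)"
    using x y coincide[OF x(1) y(1)] coincide[OF x(2) y(1)] coincide[OF x(1) y(2)]
    by (simp add: common_fixed_point_def)
  \<comment> \<open>Here \<open>v\<close> serves the pair \<open>f\<close>, \<open>F\<close> and
    \<open>w\<close> the pair \<open>g\<close>, \<open>G\<close>, so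
    \<open>v = f v = g w = w\<close>.\<close>
  moreover have "v = w" if "common_fixed_point f g F G v" "common_fixed_point f g F G w" for v w
    using that coincide[of v w] by (simp add: common_fixed_point_def)
  ultimately show ?thesis
    by blast
qed

end
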